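(* Let $L$ be a logic extending $\mathsf{N4}^\bot+\{\neg\neg(p\wedge\sim p)\leftrightarrow(p\wedge\sim p)\}$. Then $\tau_{\mathbf{B}}L$ is a modal companion of $L$.
   Context: Languages: $\mathcal{L}_\sim=\{\wedge,\vee,\to,\bot,\sim\}$ and $\mathcal{L}^\Box_\sim=\mathcal{L}_\sim\cup\{\Box,\Diamond\}$, formulas over a countable set of variables; $\neg\varphi:=\varphi\to\bot$, $\varphi\leftrightarrow\psi:=(\varphi\to\psi)\wedge(\psi\to\varphi)$, $\varphi\Leftrightarrow\psi:=(\varphi\leftrightarrow\psi)\wedge(\sim\varphi\leftrightarrow\sim\psi)$. A logic in $\mathcal{L}_\sim$ is a set of formulas closed under substitution and modus ponens; a logic in $\mathcal{L}^\Box_\sim$ is additionally closed under $\varphi\to\psi/\Box\varphi\to\Box\psi$ and $\varphi\to\psi/\Diamond\varphi\to\Diamond\psi$. $\mathsf{N4}^\bot$ is the least logic in $\mathcal{L}_\sim$ containing the intuitionistic axioms ($p\to(q\to p)$; $(p\to(q\to r))\to((p\to q)\to(p\to r))$; $p\wedge q\to p$; $p\wedge q\to q$; $p\to(q\to p\wedge q)$; $p\to p\vee q$; $q\to p\vee q$; $(p\to r)\to((q\to r)\to(p\vee q\to r))$; $\bot\to p$) and $\sim(p\vee q)\leftrightarrow(\sim p\wedge\sim q)$, $\sim(p\wedge q)\leftrightarrow(\sim p\vee\sim q)$, $\sim(p\to q)\leftrightarrow(p\wedge\sim q)$, $\sim\sim p\leftrightarrow p$, $\sim\bot$. $\mathsf{BS4}$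 is the least logic in $\mathcal{L}^\Box_\sim$ containing these axioms, $p\vee\neg p$, $\Box(p\to p)$, $(\Box p\wedge\Box q)\to\Box(p\wedge q)$, $\Box p\to p$, $\Box p\to\Box\Box p$, $\neg\Box p\leftrightarrow\Diamond\neg p$, $\neg\Diamond p\leftrightarrow\Box\neg p$, $\Box p\Leftrightarrow\sim\Diamond\sim p$, $\Diamond p\Leftrightarrow\sim\Box\sim p$. Extensions are logics containing the given one; $L+X$ is the least logic containing $L\cup X$. Translation $\mathrm{T}_{\mathbf{B}}$: $\mathrm{T}_{\mathbf{B}}(p)=\Box p$, $\mathrm{T}_{\mathbf{B}}(\sim p)=\Box\sim p$, $\mathrm{T}_{\mathbf{B}}(\bot)=\bot$, $\mathrm{T}_{\mathbf{B}}(\sim\bot)=\sim\bot$, $\mathrm{T}_{\mathbf{B}}(\varphi\wedge\psi)=\mathrm{T}_{\mathbf{B}}\varphi\wedge\mathrm{T}_{\mathbf{B}}\psi$, $\mathrm{T}_{\mathbf{B}}(\varphi\vee\psi)=\mathrm{T}_{\mathbf{B}}\varphi\vee\mathrm{T}_{\mathbf{B}}\psi$, $\mathrm{T}_{\mathbf{B}}(\varphi\to\psi)=\Box(\mathrm{T}_{\mathbf{B}}\varphi\to\mathrm{T}_{\mathbf{B}}\psi)$, $\mathrm{T}_{\mathbf{B}}(\sim(\varphi\wedge\psi))=\mathrm{T}_{\mathbf{B}}(\sim\varphi)\vee\mathrm{T}_{\mathbf{B}}(\sim\psi)$, $\mathrm{T}_{\mathbf{B}}(\sim(\varphi\vee\psi))=\mathrm{T}_{\mathbf{B}}(\sim\varphi)\wedge\mathrm{T}_{\mathbf{B}}(\sim\psi)$,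 $\mathrm{T}_{\mathbf{B}}(\sim(\varphi\to\psi))=\mathrm{T}_{\mathbf{B}}\varphi\wedge\mathrm{T}_{\mathbf{B}}(\sim\psi)$, $\mathrm{T}_{\mathbf{B}}(\sim\sim\varphi)=\mathrm{T}_{\mathbf{B}}\varphi$. A modal companion of an extension $L$ of $\mathsf{N4}^\bot$ is an extension $M$ of $\mathsf{BS4}$ with $\varphi\in L\iff\mathrm{T}_{\mathbf{B}}\varphi\in M$ for every $\mathcal{L}_\sim$-formula $\varphi$; $\tau_{\mathbf{B}}L:=\mathsf{BS4}+\{\mathrm{T}_{\mathbf{B}}\varphi:\varphi\in L\}$. *)

theory Defs
  imports Main
begin

datatype fm =
    Var nat
  | Bot
  | And fm fm  (infixr \<open>\<^bold>\<and>\<close> 75)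
  | Or fm fm   (infixr \<open>\<^bold>\<or>\<close> 70)
  | Imp fm fm  (infixr \<open>\<^bold>\<rightarrow>\<close> 65)
  | SNeg fm    (\<open>\<^bold>\<sim>_\<close> [80] 80)

abbreviation Neg :: "fm \<Rightarrow> fm"  (\<open>\<^bold>\<not>_\<close> [80] 80) where
  "\<^bold>\<not>\<phi> \<equiv> \<phi> \<^bold>\<rightarrow> Bot"

abbreviation Iff :: "fm \<Rightarrow> fm \<Rightarrow> fm"  (infix \<open>\<^bold>\<leftrightarrow>\<close> 60) where
  "\<phi> \<^bold>\<leftrightarrow> \<psi> \<equiv> (\<phi> \<^bold>\<rightarrow> \<psi>) \<^bold>\<and> (\<psi> \<^bold>\<rightarrow> \<phi>)"

primrec subst :: "(nat \<Rightarrow> fm) \<Rightarrow> fm \<Rightarrow> fm" where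
  "subst \<sigma> (Var n) = \<sigma> n"
| "subst \<sigma> Bot = Bot"
| "subst \<sigma> (\<phi> \<^bold>\<and> \<psi>) = subst \<sigma> \<phi> \<^bold>\<and> subst \<sigma> \<psi>"
| "subst \<sigma> (\<phi> \<^bold>\<or> \<psi>) = subst \<sigma> \<phi> \<^bold>\<or> subst \<sigma> \<psi>"
| "subst \<sigma> (\<phi> \<^bold>\<rightarrow> \<psi>) = subst \<sigma> \<phi> \<^bold>\<rightarrow> subst \<sigma> \<psi>"
| "subst \<sigma> (\<^bold>\<sim>\<phi>) = \<^bold>\<sim>(subst \<sigma> \<phi>)"

definition is_logic :: "fm set \<Rightarrow> bool" where
  "is_logic L \<longleftrightarrow>
     (\<forall>\<sigma> \<phi>. \<phi> \<in> L \<longrightarrow> subst \<sigma> \<phi> \<in> L) \<and>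
     (\<forall>\<phi> \<psi>. \<phi> \<in> L \<longrightarrow> \<phi> \<^bold>\<rightarrow> \<psi> \<in> L \<longrightarrow> \<psi> \<in> L)"

definition least_logic :: "fm set \<Rightarrow> fm set" where
  "least_logic X = \<Inter>{L. is_logic L \<and> X \<subseteq> L}"

definition plus_logic :: "fm set \<Rightarrow> fm set \<Rightarrow> fm set"  (infixl \<open>\<^bold>+\<close> 65) where
  "L \<^bold>+ X = least_logic (L \<union> X)"

definition is_extension :: "fm set \<Rightarrow> fm set \<Rightarrow> bool" where
  "is_extension L' L \<longleftrightarrow> is_logic L' \<and> L \<subseteq> L'"

definition N4bot_axioms :: "fm set" where
  "N4bot_axioms = (let p = Var 0; q = Var 1; r = Var 2 in
    {p \<^bold>\<rightarrow> (q \<^bold>\<rightarrow> p),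
     (p \<^bold>\<rightarrow> (q \<^bold>\<rightarrow> r)) \<^bold>\<rightarrow> ((p \<^bold>\<rightarrow> q) \<^bold>\<rightarrow> (p \<^bold>\<rightarrow> r)),
     (p \<^bold>\<and> q) \<^bold>\<rightarrow> p,
     (p \<^bold>\<and> q) \<^bold>\<rightarrow> q,
     p \<^bold>\<rightarrow> (q \<^bold>\<rightarrow> (p \<^bold>\<and> q)),
     p \<^bold>\<rightarrow> (p \<^bold>\<or> q),
     q \<^bold>\<rightarrow> (p \<^bold>\<or> q),
     (p \<^bold>\<rightarrow> r) \<^bold>\<rightarrow> ((q \<^bold>\<rightarrow> r) \<^bold>\<rightarrow> ((p \<^bold>\<or> q) \<^bold>\<rightarrow> r)),
     Bot \<^bold>\<rightarrow> p,
     \<^bold>\<sim>(p \<^bold>\<or> q) \<^bold>\<leftrightarrow> (\<^bold>\<sim>p \<^bold>\<and> \<^bold>\<sim>q),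
     \<^bold>\<sim>(p \<^bold>\<and> q) \<^bold>\<leftrightarrow> (\<^bold>\<sim>p \<^bold>\<or> \<^bold>\<sim>q),
     \<^bold>\<sim>(p \<^bold>\<rightarrow> q) \<^bold>\<leftrightarrow> (p \<^bold>\<and> \<^bold>\<sim>q),
     \<^bold>\<sim>(\<^bold>\<sim>p) \<^bold>\<leftrightarrow> p,
     \<^bold>\<sim>Bot})"

definition N4bot :: "fm set" where
  "N4bot = least_logic N4bot_axioms"

datatype mfm =
    MVar nat
  | MBot
  | MAnd mfm mfm  (infixr \<open>\<^bold>\<and>\<^sub>m\<close> 75)
  | MOr mfm mfm   (infixr \<open>\<^bold>\<or>\<^sub>m\<close> 70)
  | MImp mfm mfm  (infixr \<open>\<^bold>\<rightarrow>\<^sub>m\<close> 65)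
  | MSNeg mfm     (\<open>\<^bold>\<sim>\<^sub>m_\<close> [80] 80)
  | Box mfm       (\<open>\<^bold>\<box>_\<close> [80] 80)
  | Dia mfm       (\<open>\<^bold>\<diamond>_\<close> [80] 80)

abbreviation MNeg :: "mfm \<Rightarrow> mfm"  (\<open>\<^bold>\<not>\<^sub>m_\<close> [80] 80) where
  "\<^bold>\<not>\<^sub>m\<phi> \<equiv> \<phi> \<^bold>\<rightarrow>\<^sub>m MBot"

abbreviation MIff :: "mfm \<Rightarrow> mfm \<Rightarrow> mfm"  (infix \<open>\<^bold>\<leftrightarrow>\<^sub>m\<close> 60) where
  "\<phi> \<^bold>\<leftrightarrow>\<^sub>m \<psi> \<equiv> (\<phi> \<^bold>\<rightarrow>\<^sub>m \<psi>) \<^bold>\<and>\<^sub>m (\<psi> \<^bold>\<rightarrow>\<^sub>m \<phi>)"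

abbreviation MSIff :: "mfm \<Rightarrow> mfm \<Rightarrow> mfm"  (infix \<open>\<^bold>\<Leftrightarrow>\<^sub>m\<close> 60) where
  "\<phi> \<^bold>\<Leftrightarrow>\<^sub>m \<psi> \<equiv> (\<phi> \<^bold>\<leftrightarrow>\<^sub>m \<psi>) \<^bold>\<and>\<^sub>m (\<^bold>\<sim>\<^sub>m\<phi> \<^bold>\<leftrightarrow>\<^sub>m \<^bold>\<sim>\<^sub>m\<psi>)"

primrec msubst :: "(nat \<Rightarrow> mfm) \<Rightarrow> mfm \<Rightarrow> mfm" where
  "msubst \<sigma> (MVar n) = \<sigma> n"
| "msubst \<sigma> MBot = MBot"
| "msubst \<sigma> (\<phi> \<^bold>\<and>\<^sub>m \<psi>) = msubst \<sigma> \<phi> \<^bold>\<and>\<^sub>m msubst \<sigma> \<psi>"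
| "msubst \<sigma> (\<phi> \<^bold>\<or>\<^sub>m \<psi>) = msubst \<sigma> \<phi> \<^bold>\<or>\<^sub>m msubst \<sigma> \<psi>"
| "msubst \<sigma> (\<phi> \<^bold>\<rightarrow>\<^sub>m \<psi>) = msubst \<sigma> \<phi> \<^bold>\<rightarrow>\<^sub>m msubst \<sigma> \<psi>"
| "msubst \<sigma> (\<^bold>\<sim>\<^sub>m\<phi>) = \<^bold>\<sim>\<^sub>m(msubst \<sigma> \<phi>)"
| "msubst \<sigma> (\<^bold>\<box>\<phi>) = \<^bold>\<box>(msubst \<sigma> \<phi>)"
| "msubst \<sigma> (\<^bold>\<diamond>\<phi>) = \<^bold>\<diamond>(msubst \<sigma> \<phi>)"

definition is_mlogic :: "mfm set \<Rightarrow> bool" where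
  "is_mlogic M \<longleftrightarrow>
     (\<forall>\<sigma> \<phi>. \<phi> \<in> M \<longrightarrow> msubst \<sigma> \<phi> \<in> M) \<and>
     (\<forall>\<phi> \<psi>. \<phi> \<in> M \<longrightarrow> \<phi> \<^bold>\<rightarrow>\<^sub>m \<psi> \<in> M \<longrightarrow> \<psi> \<in> M) \<and>
     (\<forall>\<phi> \<psi>. \<phi> \<^bold>\<rightarrow>\<^sub>m \<psi> \<in> M \<longrightarrow> \<^bold>\<box>\<phi> \<^bold>\<rightarrow>\<^sub>m \<^bold>\<box>\<psi> \<in> M) \<and>
     (\<forall>\<phi> \<psi>. \<phi> \<^bold>\<rightarrow>\<^sub>m \<psi> \<in> M \<longrightarrow> \<^bold>\<diamond>\<phi> \<^bold>\<rightarrow>\<^sub>m \<^bold>\<diamond>\<psi> \<in> M)"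

definition least_mlogic :: "mfm set \<Rightarrow> mfm set" where
  "least_mlogic X = \<Inter>{M. is_mlogic M \<and> X \<subseteq> M}"

definition plus_mlogic :: "mfm set \<Rightarrow> mfm set \<Rightarrow> mfm set"  (infixl \<open>\<^bold>+\<^sub>m\<close> 65) where
  "M \<^bold>+\<^sub>m X = least_mlogic (M \<union> X)"

definition is_mextension :: "mfm set \<Rightarrow> mfm set \<Rightarrow> bool" where
  "is_mextension M' M \<longleftrightarrow> is_mlogic M' \<and> M \<subseteq> M'"

primrec emb :: "fm \<Rightarrow> mfm" where
  "emb (Var n) = MVar n"
| "emb Bot = MBot"
| "emb (\<phi> \<^bold>\<and> \<psi>) = emb \<phi> \<^bold>\<and>\<^sub>m emb \<psi>"
| "emb (\<phi> \<^bold>\<or> \<psi>) = emb \<phi> \<^bold>\<or>\<^sub>m emb \<psi>"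
| "emb (\<phi> \<^bold>\<rightarrow> \<psi>) = emb \<phi> \<^bold>\<rightarrow>\<^sub>m emb \<psi>"
| "emb (\<^bold>\<sim>\<phi>) = \<^bold>\<sim>\<^sub>m(emb \<phi>)"

definition BS4_axioms :: "mfm set" where
  "BS4_axioms = emb ` N4bot_axioms \<union> (let p = MVar 0; q = MVar 1 in
    {p \<^bold>\<or>\<^sub>m \<^bold>\<not>\<^sub>mp,
     \<^bold>\<box>(p \<^bold>\<rightarrow>\<^sub>m p),
     (\<^bold>\<box>p \<^bold>\<and>\<^sub>m \<^bold>\<box>q) \<^bold>\<rightarrow>\<^sub>m \<^bold>\<box>(p \<^bold>\<and>\<^sub>m q),
     \<^bold>\<box>p \<^bold>\<rightarrow>\<^sub>m p,
     \<^bold>\<box>p \<^bold>\<rightarrow>\<^sub>m \<^bold>\<box>(\<^bold>\<box>p),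
     \<^bold>\<not>\<^sub>m(\<^bold>\<box>p) \<^bold>\<leftrightarrow>\<^sub>m \<^bold>\<diamond>(\<^bold>\<not>\<^sub>mp),
     \<^bold>\<not>\<^sub>m(\<^bold>\<diamond>p) \<^bold>\<leftrightarrow>\<^sub>m \<^bold>\<box>(\<^bold>\<not>\<^sub>mp),
     \<^bold>\<box>p \<^bold>\<Leftrightarrow>\<^sub>m \<^bold>\<sim>\<^sub>m(\<^bold>\<diamond>(\<^bold>\<sim>\<^sub>mp)),
     \<^bold>\<diamond>p \<^bold>\<Leftrightarrow>\<^sub>m \<^bold>\<sim>\<^sub>m(\<^bold>\<box>(\<^bold>\<sim>\<^sub>mp))})"

definition BS4 :: "mfm set" where
  "BS4 = least_mlogic BS4_axioms"

fun TB :: "fm \<Rightarrow> mfm" where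
  "TB (Var n) = \<^bold>\<box>(MVar n)"
| "TB Bot = MBot"
| "TB (\<phi> \<^bold>\<and> \<psi>) = TB \<phi> \<^bold>\<and>\<^sub>m TB \<psi>"
| "TB (\<phi> \<^bold>\<or> \<psi>) = TB \<phi> \<^bold>\<or>\<^sub>m TB \<psi>"
| "TB (\<phi> \<^bold>\<rightarrow> \<psi>) = \<^bold>\<box>(TB \<phi> \<^bold>\<rightarrow>\<^sub>m TB \<psi>)"
| "TB (\<^bold>\<sim>(Var n)) = \<^bold>\<box>(\<^bold>\<sim>\<^sub>m(MVar n))"
| "TB (\<^bold>\<sim>Bot) = \<^bold>\<sim>\<^sub>mMBot"
| "TB (\<^bold>\<sim>(\<phi> \<^bold>\<and> \<psi>)) = TB (\<^bold>\<sim>\<phi>) \<^bold>\<or>\<^sub>m TB (\<^bold>\<sim>\<psi>)"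
| "TB (\<^bold>\<sim>(\<phi> \<^bold>\<or> \<psi>)) = TB (\<^bold>\<sim>\<phi>) \<^bold>\<and>\<^sub>m TB (\<^bold>\<sim>\<psi>)"
| "TB (\<^bold>\<sim>(\<phi> \<^bold>\<rightarrow> \<psi>)) = TB \<phi> \<^bold>\<and>\<^sub>m TB (\<^bold>\<sim>\<psi>)"
| "TB (\<^bold>\<sim>(\<^bold>\<sim>\<phi>)) = TB \<phi>"

definition modal_companion :: "mfm set \<Rightarrow> fm set \<Rightarrow> bool" where
  "modal_companion M L \<longleftrightarrow>
     is_extension L N4bot \<and> is_mextension M BS4 \<and> (\<forall>\<phi>. \<phi> \<in> L \<longleftrightarrow> TB \<phi> \<in> M)"

definition tauB :: "fm set \<Rightarrow> mfm set" where
  "tauB L = BS4 \<^bold>+\<^sub>m TB ` L"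

end

theory Submission imports Defs begin

text \<open>
  Let \<open>W\<close> be the set of prime theories of \<open>L\<close>, ordered by inclusion, and \<open>B\<close> the Boolean algebra of
  subsets of \<open>W\<close> generated by the extents \<open>[\<phi>] = {w. \<phi> \<in> w}\<close>. The interior operator \<open>I\<close> of the order
  maps \<open>B\<close> onto the extents. A \<open>BS4\<close>-model is the twist structure of those pairs
  \<open>(a, b)\<close> over \<open>B\<close> for which \<open>a \<union> b\<close> lies in the filter generated by the sets \<open>[\<phi>] \<union> [\<sim>\<phi>]\<close> and
  \<open>a \<inter> b\<close> lies in the ideal generated by the closures of the sets \<open>[\<phi>] \<inter> [\<sim>\<phi>]\<close>.
  Since every set in \<open>B\<close> is decided on a dense open set, and since \<open>[\<phi> \<and> \<sim>\<phi>]\<close> is regular open by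
  the additional axiom, \<open>(I a, I b)\<close> again has the form \<open>([\<chi>], [\<sim>\<chi>])\<close>. Hence translated formulas
  are evaluated as substitution instances of the original ones, so the model validates the
  translation of \<open>L\<close> and refutes the translation of every formula outside \<open>L\<close>.
\<close>

section \<open>Prime theories\<close>

locale n4_logic =
  fixes L :: "fm set"
  assumes logic: "is_logic L"
    and axioms: "N4bot_axioms \<subseteq> L"
begin

lemma subst_closed: "\<phi> \<in> L \<Longrightarrow> subst \<sigma> \<phi> \<in> L"
  using logic unfolding is_logic_def by blast

lemma axiom_instance:
  assumes "\<phi> \<in> N4bot_axioms"
  shows "subst (\<lambda>n. if n = 0 then x else if n = 1 then y else z) \<phi> \<in> L"
  using assms axioms by (blast intro: subst_closed)

lemma axiom_schemes:
  "x \<^bold>\<rightarrow> (y \<^bold>\<rightarrow> x) \<in> L"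
  "(x \<^bold>\<rightarrow> (y \<^bold>\<rightarrow> z)) \<^bold>\<rightarrow> ((x \<^bold>\<rightarrow> y) \<^bold>\<rightarrow> (x \<^bold>\<rightarrow> z)) \<in> L"
  "(x \<^bold>\<and> y) \<^bold>\<rightarrow> x \<in> L"
  "(x \<^bold>\<and> y) \<^bold>\<rightarrow> y \<in> L"
  "x \<^bold>\<rightarrow> (y \<^bold>\<rightarrow> (x \<^bold>\<and> y)) \<in> L"
  "x \<^bold>\<rightarrow> (x \<^bold>\<or> y) \<in> L"
  "y \<^bold>\<rightarrow> (x \<^bold>\<or> y) \<in> L"
  "(x \<^bold>\<rightarrow> z) \<^bold>\<rightarrow> ((y \<^bold>\<rightarrow> z) \<^bold>\<rightarrow> ((x \<^bold>\<or> y) \<^bold>\<rightarrow> z)) \<in> L"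
  "Bot \<^bold>\<rightarrow> x \<in> L"
  "\<^bold>\<sim>(x \<^bold>\<or> y) \<^bold>\<leftrightarrow> (\<^bold>\<sim>x \<^bold>\<and> \<^bold>\<sim>y) \<in> L"
  "\<^bold>\<sim>(x \<^bold>\<and> y) \<^bold>\<leftrightarrow> (\<^bold>\<sim>x \<^bold>\<or> \<^bold>\<sim>y) \<in> L"
  "\<^bold>\<sim>(x \<^bold>\<rightarrow> y) \<^bold>\<leftrightarrow> (x \<^bold>\<and> \<^bold>\<sim>y) \<in> L"
  "\<^bold>\<sim>(\<^bold>\<sim>x) \<^bold>\<leftrightarrow> x \<in> L"
  "\<^bold>\<sim>Bot \<in> L"
proof -
  have *: "\<forall>\<phi>\<in>N4bot_axioms. subst (\<lambda>n. if n = 0 then x else if n = 1 then y else z) \<phi> \<in> L"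
    using axiom_instance by blast
  note ** = *[unfolded N4bot_axioms_def Let_def, simplified]
  show
    "x \<^bold>\<rightarrow> (y \<^bold>\<rightarrow> x) \<in> L"
    "(x \<^bold>\<rightarrow> (y \<^bold>\<rightarrow> z)) \<^bold>\<rightarrow> ((x \<^bold>\<rightarrow> y) \<^bold>\<rightarrow> (x \<^bold>\<rightarrow> z)) \<in> L"
    "(x \<^bold>\<and> y) \<^bold>\<rightarrow> x \<in> L"
    "(x \<^bold>\<and> y) \<^bold>\<rightarrow> y \<in> L"
    "x \<^bold>\<rightarrow> (y \<^bold>\<rightarrow> (x \<^bold>\<and> y)) \<in> L"
    "x \<^bold>\<rightarrow> (x \<^bold>\<or> y) \<in> L"
    "y \<^bold>\<rightarrow> (x \<^bold>\<or> y) \<in> L"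
    "(x \<^bold>\<rightarrow> z) \<^bold>\<rightarrow> ((y \<^bold>\<rightarrow> z) \<^bold>\<rightarrow> ((x \<^bold>\<or> y) \<^bold>\<rightarrow> z)) \<in> L"
    "Bot \<^bold>\<rightarrow> x \<in> L"
    "\<^bold>\<sim>(x \<^bold>\<or> y) \<^bold>\<leftrightarrow> (\<^bold>\<sim>x \<^bold>\<and> \<^bold>\<sim>y) \<in> L"
    "\<^bold>\<sim>(x \<^bold>\<and> y) \<^bold>\<leftrightarrow> (\<^bold>\<sim>x \<^bold>\<or> \<^bold>\<sim>y) \<in> L"
    "\<^bold>\<sim>(x \<^bold>\<rightarrow> y) \<^bold>\<leftrightarrow> (x \<^bold>\<and> \<^bold>\<sim>y) \<in> L"
    "\<^bold>\<sim>(\<^bold>\<sim>x) \<^bold>\<leftrightarrow> x \<in> L"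
    "\<^bold>\<sim>Bot \<in> L"
    using ** by simp_all
qed

definition is_theory :: "fm set \<Rightarrow> bool" where
  "is_theory \<Gamma> \<longleftrightarrow> L \<subseteq> \<Gamma> \<and> (\<forall>x y. x \<in> \<Gamma> \<longrightarrow> x \<^bold>\<rightarrow> y \<in> \<Gamma> \<longrightarrow> y \<in> \<Gamma>)"

lemma theory_mp: "is_theory \<Gamma> \<Longrightarrow> x \<^bold>\<rightarrow> y \<in> \<Gamma> \<Longrightarrow> x \<in> \<Gamma> \<Longrightarrow> y \<in> \<Gamma>"
  unfolding is_theory_def by blast

lemma theory_logic: "is_theory \<Gamma> \<Longrightarrow> x \<in> L \<Longrightarrow> x \<in> \<Gamma>"
  unfolding is_theory_def by blast

lemma theory_L: "is_theory L"
  using logic unfolding is_theory_def is_logic_def by blast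

text \<open>By the deduction theorem this set is the theory generated by \<open>\<Gamma>\<close> and
  \<open>x\<close>; it replaces a derivability relation.\<close>

lemma theory_extend:
  assumes "is_theory \<Gamma>"
  shows "is_theory {y. x \<^bold>\<rightarrow> y \<in> \<Gamma>}" "\<Gamma> \<subseteq> {y. x \<^bold>\<rightarrow> y \<in> \<Gamma>}" "x \<in> {y. x \<^bold>\<rightarrow> y \<in> \<Gamma>}"
proof -
  note mp = theory_mp[OF assms] and ax = axiom_schemes[THEN theory_logic[OF assms]]
  show sub: "\<Gamma> \<subseteq> {y. x \<^bold>\<rightarrow> y \<in> \<Gamma>}"
    using mp[OF ax(1)] by blast
  show "is_theory {y. x \<^bold>\<rightarrow> y \<in> \<Gamma>}"
    using sub assms mp[OF mp[OF ax(2)]] unfolding is_theory_def by blast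
  show "x \<in> {y. x \<^bold>\<rightarrow> y \<in> \<Gamma>}"
    \<comment> \<open>The usual SKK derivation of \<open>x -> x\<close> from the first two
      schemes.\<close>
    using mp[OF mp[OF ax(2) ax(1)] ax(1)[of x x]] by blast
qed

definition W :: "fm set set" where
  "W = {w. is_theory w \<and> Bot \<notin> w \<and> (\<forall>x y. x \<^bold>\<or> y \<in> w \<longrightarrow> x \<in> w \<or> y \<in> w)}"

text \<open>Lindenbaum's lemma: a theory maximal among those that extend \<open>\<Gamma>\<close> and
  omit \<open>c\<close> contains \<open>x -> c\<close> for every missing \<open>x\<close>, so a
  disjunction of two missing formulas would yield \<open>c\<close>.\<close>

lemma prime_extension:
  assumes "is_theory \<Gamma>" "c \<notin> \<Gamma>"
  obtains w where "w \<in> W" "\<Gamma> \<subseteq> w" "c \<notin> w"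
proof -
  let ?A = "{\<Delta>. is_theory \<Delta> \<and> \<Gamma> \<subseteq> \<Delta> \<and> c \<notin> \<Delta>}"
  have "\<exists>M\<in>?A. \<forall>X\<in>?A. M \<subseteq> X \<longrightarrow> X = M"
  proof (rule subset_Zorn_nonempty)
    show "?A \<noteq> {}" using assms by blast
  next
    fix C assume ne: "C \<noteq> {}" and chain: "subset.chain ?A C"
    have mem: "\<And>X. X \<in> C \<Longrightarrow> is_theory X \<and> \<Gamma> \<subseteq> X \<and> c \<notin> X"
      using chain by (auto simp: subset.chain_def)
    have comp: "\<And>X Y. X \<in> C \<Longrightarrow> Y \<in> C \<Longrightarrow> X \<subseteq> Y \<or> Y \<subseteq> X"
      using chain by (auto simp: subset.chain_def)
    have "y \<in> \<Union>C" if "x \<in> \<Union>C" "x \<^bold>\<rightarrow> y \<in> \<Union>C" for x y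
    proof -
      from that obtain X Y where XY: "X \<in> C" "x \<in> X" "Y \<in> C" "x \<^bold>\<rightarrow> y \<in> Y" by blast
      from comp[OF XY(1,3)] show ?thesis
      proof
        assume "X \<subseteq> Y"
        then have "y \<in> Y" using XY mem theory_mp[of Y x y] by blast
        then show ?thesis using XY(3) by blast
      next
        assume "Y \<subseteq> X"
        then have "y \<in> X" using XY mem theory_mp[of X x y] by blast
        then show ?thesis using XY(1) by blast
      qed
    qed
    moreover have "L \<subseteq> \<Union>C" "\<Gamma> \<subseteq> \<Union>C" "c \<notin> \<Union>C"
    proof -
      from ne obtain X where "X \<in> C" by blast
      then show "L \<subseteq> \<Union>C" "\<Gamma> \<subseteq> \<Union>C"
        using mem[of X] theory_logic by blast+
      show "c \<notin> \<Union>C" using mem by blast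
    qed
    ultimately show "\<Union>C \<in> ?A"
      unfolding is_theory_def by blast
  qed
  then obtain M where MA: "M \<in> ?A" and maxA: "\<forall>X\<in>?A. M \<subseteq> X \<longrightarrow> X = M"
    by (elim bexE)
  then have M: "is_theory M" "\<Gamma> \<subseteq> M" "c \<notin> M" by simp_all
  have max: "X = M" if "is_theory X" "M \<subseteq> X" "c \<notin> X" for X
    using maxA[rule_format, of X] that M(2) by simp
  note mp = theory_mp[OF M(1)] and ax = axiom_schemes[THEN theory_logic[OF M(1)]]
  have imp: "x \<^bold>\<rightarrow> c \<in> M" if "x \<notin> M" for x
  proof (rule ccontr)
    assume "x \<^bold>\<rightarrow> c \<notin> M"
    then have "{y. x \<^bold>\<rightarrow> y \<in> M} = M"
      using max[OF theory_extend(1,2)[OF M(1), of x]] by simp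
    with theory_extend(3)[OF M(1), of x] that show False by simp
  qed
  have "x \<in> M \<or> y \<in> M" if "x \<^bold>\<or> y \<in> M" for x y
  proof (rule ccontr)
    assume "\<not> (x \<in> M \<or> y \<in> M)"
    then have "x \<^bold>\<rightarrow> c \<in> M" "y \<^bold>\<rightarrow> c \<in> M" by (simp_all add: imp)
    then have "c \<in> M" using mp[OF mp[OF mp[OF ax(8)]] that] by simp
    with M(3) show False ..
  qed
  moreover have "Bot \<notin> M"
    using mp[OF ax(9)[of c]] M(3) by auto
  ultimately have "M \<in> W"
    using M(1) unfolding W_def by blast
  with M that show thesis by blast
qed

section \<open>Truth conditions at prime theories\<close>

lemma W_theory: "w \<in> W \<Longrightarrow> is_theory w"
  unfolding W_def by blast

lemma logic_in_world: "x \<in> L \<Longrightarrow> w \<in> W \<Longrightarrow> x \<in> w"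
  using W_theory theory_logic by blast

lemma world_mp: "w \<in> W \<Longrightarrow> x \<^bold>\<rightarrow> y \<in> w \<Longrightarrow> x \<in> w \<Longrightarrow> y \<in> w"
  using W_theory theory_mp by blast

lemma world_And [simp]: "w \<in> W \<Longrightarrow> x \<^bold>\<and> y \<in> w \<longleftrightarrow> x \<in> w \<and> y \<in> w"
  using axiom_schemes(3-5)[of x y, THEN logic_in_world, of w] world_mp[of w] by blast

lemma world_prime: "w \<in> W \<Longrightarrow> x \<^bold>\<or> y \<in> w \<Longrightarrow> x \<in> w \<or> y \<in> w"
  unfolding W_def by blast

lemma world_Or [simp]: "w \<in> W \<Longrightarrow> x \<^bold>\<or> y \<in> w \<longleftrightarrow> x \<in> w \<or> y \<in> w"
  using axiom_schemes(6)[of x y, THEN logic_in_world, of w]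
    axiom_schemes(7)[of y x, THEN logic_in_world, of w] world_mp[of w] world_prime[of w x y]
  by blast

lemma world_Bot [simp]: "w \<in> W \<Longrightarrow> Bot \<notin> w"
  unfolding W_def by blast

text \<open>If \<open>x -> y\<close> is not in \<open>w\<close>, the theory generated by
  \<open>w\<close> and \<open>x\<close> omits \<open>y\<close>, and a prime extension of it is a
  counterexample above \<open>w\<close>.\<close>

lemma world_Imp:
  assumes "w \<in> W"
  shows "x \<^bold>\<rightarrow> y \<in> w \<longleftrightarrow> (\<forall>v\<in>W. w \<subseteq> v \<longrightarrow> x \<in> v \<longrightarrow> y \<in> v)"
proof
  show "x \<^bold>\<rightarrow> y \<in> w \<Longrightarrow> \<forall>v\<in>W. w \<subseteq> v \<longrightarrow> x \<in> v \<longrightarrow> y \<in> v"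
    using world_mp by blast
next
  assume *: "\<forall>v\<in>W. w \<subseteq> v \<longrightarrow> x \<in> v \<longrightarrow> y \<in> v"
  show "x \<^bold>\<rightarrow> y \<in> w"
  proof (rule ccontr)
    assume "x \<^bold>\<rightarrow> y \<notin> w"
    then have "y \<notin> {z. x \<^bold>\<rightarrow> z \<in> w}" by simp
    with theory_extend[OF W_theory[OF assms], of x] obtain v
      where "v \<in> W" "{z. x \<^bold>\<rightarrow> z \<in> w} \<subseteq> v" "y \<notin> v"
      using prime_extension by metis
    with * theory_extend(2,3)[OF W_theory[OF assms], of x] show False by blast
  qed
qed

lemma world_iff: "w \<in> W \<Longrightarrow> x \<^bold>\<leftrightarrow> y \<in> L \<Longrightarrow> x \<in> w \<longleftrightarrow> y \<in> w"
  using logic_in_world[of "x \<^bold>\<leftrightarrow> y" w] world_mp[of w x y] world_mp[of w y x] by auto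

lemma world_SNeg [simp]:
  assumes "w \<in> W"
  shows "\<^bold>\<sim>(x \<^bold>\<or> y) \<in> w \<longleftrightarrow> \<^bold>\<sim>x \<in> w \<and> \<^bold>\<sim>y \<in> w"
    "\<^bold>\<sim>(x \<^bold>\<and> y) \<in> w \<longleftrightarrow> \<^bold>\<sim>x \<in> w \<or> \<^bold>\<sim>y \<in> w"
    "\<^bold>\<sim>(x \<^bold>\<rightarrow> y) \<in> w \<longleftrightarrow> x \<in> w \<and> \<^bold>\<sim>y \<in> w"
    "\<^bold>\<sim>(\<^bold>\<sim>x) \<in> w \<longleftrightarrow> x \<in> w"
    "\<^bold>\<sim>Bot \<in> w"
  using world_iff[OF assms axiom_schemes(10)[of x y]] world_iff[OF assms axiom_schemes(11)[of x y]]
    world_iff[OF assms axiom_schemes(12)[of x y]] world_iff[OF assms axiom_schemes(13)[of x]]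
    logic_in_world[OF axiom_schemes(14) assms]
  by (simp_all add: assms)

definition extent :: "fm \<Rightarrow> fm set set" where
  "extent x = {w \<in> W. x \<in> w}"

lemma in_extent: "w \<in> extent x \<longleftrightarrow> w \<in> W \<and> x \<in> w"
  by (simp add: extent_def)

lemma extent_Bot: "extent Bot = {}"
  by (auto simp: extent_def)

text \<open>Completeness: \<open>L\<close> is itself a theory, so some prime theory omits any given
  formula outside \<open>L\<close>.\<close>

lemma extent_eq_W_iff: "extent x = W \<longleftrightarrow> x \<in> L"
proof
  assume *: "extent x = W"
  show "x \<in> L"
  proof (rule ccontr)
    assume "x \<notin> L"
    then obtain w where "w \<in> W" "x \<notin> w" using prime_extension[OF theory_L] by blast
    with * show False by (auto simp: extent_def)
  qed
qed (auto simp: extent_def logic_in_world)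

section \<open>The Boolean algebra generated by the extents\<close>

text \<open>The open sets are the upward closed subsets of \<open>W\<close>, so the dual operator
  \<open>Cl\<close> is downward closure.\<close>

definition Interior :: "fm set set \<Rightarrow> fm set set" where
  "Interior a = {w \<in> W. \<forall>v\<in>W. w \<subseteq> v \<longrightarrow> v \<in> a}"

definition Cl :: "fm set set \<Rightarrow> fm set set" where
  "Cl a = {w \<in> W. \<exists>v\<in>W. w \<subseteq> v \<and> v \<in> a}"

text \<open>A list of pairs stands for a conjunctive normal form with one clause \<open>-[x] \<union> [y]\<close> for each
  pair \<open>(x, y)\<close>.\<close>

definition cnf :: "(fm \<times> fm) list \<Rightarrow> fm set set" where
  "cnf S = {w \<in> W. \<forall>(x, y)\<in>set S. x \<in> w \<longrightarrow> y \<in> w}"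

definition B :: "fm set set set" where
  "B = range cnf"

lemma B_subset: "a \<in> B \<Longrightarrow> a \<subseteq> W"
  by (auto simp: B_def cnf_def)

lemma B_Int [intro]: "a \<in> B \<Longrightarrow> b \<in> B \<Longrightarrow> a \<inter> b \<in> B"
proof -
  have "cnf S \<inter> cnf T = cnf (S @ T)" for S T by (auto simp: cnf_def)
  then show "a \<in> B \<Longrightarrow> b \<in> B \<Longrightarrow> a \<inter> b \<in> B" by (auto simp: B_def)
qed

text \<open>Union distributes over the clauses, and by primeness the clauses for
  \<open>(x, y)\<close> and \<open>(x', y')\<close> merge into the one for \<open>x\<close> and
  \<open>x'\<close> conjoined, \<open>y\<close> and \<open>y'\<close> disjoined.\<close>

lemma B_Un [intro]: "a \<in> B \<Longrightarrow> b \<in> B \<Longrightarrow> a \<union> b \<in> B"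
proof -
  have "cnf S \<union> cnf T = cnf (map (\<lambda>((x, y), (x', y')). (x \<^bold>\<and> x', y \<^bold>\<or> y')) (List.product S T))" for S T
    by (fastforce simp: cnf_def)
  then show "a \<in> B \<Longrightarrow> b \<in> B \<Longrightarrow> a \<union> b \<in> B" by (auto simp: B_def)
qed

lemma B_extent [intro]: "extent x \<in> B"
proof -
  have "extent x = cnf [(Bot \<^bold>\<rightarrow> Bot, x)]" by (auto simp: cnf_def extent_def world_Imp)
  then show ?thesis by (simp add: B_def)
qed

lemma B_compl_extent: "W - extent x \<in> B"
proof -
  have "W - extent x = cnf [(x, Bot)]" by (auto simp: cnf_def extent_def)
  then show ?thesis by (simp add: B_def)
qed

lemma B_empty [intro]: "{} \<in> B"
  using B_extent[of Bot] by (simp add: extent_Bot)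

lemma B_W [intro]: "W \<in> B"
  using B_compl_extent[of Bot] by (simp add: extent_Bot)

lemma B_compl [intro]:
  assumes "a \<in> B" shows "W - a \<in> B"
proof -
  have "W - cnf S \<in> B" for S
  proof (induction S)
    case Nil
    then show ?case using B_empty by (simp add: cnf_def)
  next
    case (Cons s S)
    obtain x y where s: "s = (x, y)" by fastforce
    have "W - cnf (s # S) = (extent x \<inter> (W - extent y)) \<union> (W - cnf S)"
      by (auto simp: cnf_def extent_def s)
    then show ?case using Cons B_compl_extent by auto
  qed
  with assms show ?thesis by (auto simp: B_def)
qed

text \<open>The interior commutes with finite intersections and sends the clause
  \<open>-[x] \<union> [y]\<close> to \<open>[x -> y]\<close>, which makes conjunctive normal forms
  the convenient representation.\<close>

lemma Interior_is_extent:
  assumes "a \<in> B"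
  obtains x where "Interior a = extent x"
proof -
  have "\<exists>x. Interior (cnf S) = extent x" for S
  proof (induction S)
    case Nil
    have "Interior (cnf []) = extent (Bot \<^bold>\<rightarrow> Bot)" by (auto simp: Interior_def cnf_def extent_def world_Imp)
    then show ?case by blast
  next
    case (Cons s S)
    obtain x y where s: "s = (x, y)" by fastforce
    from Cons obtain z where z: "Interior (cnf S) = extent z" by blast
    have "Interior (cnf (s # S)) = extent (x \<^bold>\<rightarrow> y) \<inter> Interior (cnf S)"
      by (auto simp: Interior_def cnf_def extent_def world_Imp s)
    also have "\<dots> = extent ((x \<^bold>\<rightarrow> y) \<^bold>\<and> z)" by (auto simp: z extent_def)
    finally show ?case by blast
  qed
  with assms that show thesis by (auto simp: B_def)
qed

lemma Interior_extent [simp]: "Interior (extent x) = extent x"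
  by (auto simp: Interior_def extent_def)

lemma Interior_subset: "Interior a \<subseteq> a"
  by (auto simp: Interior_def)

lemma Interior_mono: "a \<subseteq> b \<Longrightarrow> Interior a \<subseteq> Interior b"
  by (auto simp: Interior_def)

lemma Cl_mono: "a \<subseteq> b \<Longrightarrow> Cl a \<subseteq> Cl b"
  by (auto simp: Cl_def)

lemma Cl_Cl: "Cl (Cl a) \<subseteq> Cl a"
  by (auto simp: Cl_def)

lemma Cl_Un: "Cl (a \<union> b) = Cl a \<union> Cl b"
  by (auto simp: Cl_def)

lemma subset_Cl: "a \<subseteq> W \<Longrightarrow> a \<subseteq> Cl a"
  by (auto simp: Cl_def)

lemma Cl_eq: "Cl a = W - Interior (W - a)"
  by (auto simp: Cl_def Interior_def)

lemma B_Interior [intro]: "a \<in> B \<Longrightarrow> Interior a \<in> B"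
  using Interior_is_extent by (metis B_extent)

lemma B_Cl [intro]: "a \<in> B \<Longrightarrow> Cl a \<in> B"
  by (auto simp: Cl_eq)

lemma Interior_up: "w \<in> Interior a \<Longrightarrow> w \<subseteq> v \<Longrightarrow> v \<in> W \<Longrightarrow> v \<in> Interior a"
  by (auto simp: Interior_def)

section \<open>Density of the worlds that decide a set\<close>

lemma extent_decided_above:
  assumes "w \<in> W"
  obtains v where "v \<in> W" "w \<subseteq> v" "v \<in> Interior (extent x) \<union> Interior (W - extent x)"
proof (cases "\<exists>v\<in>W. w \<subseteq> v \<and> x \<in> v")
  case True
  then obtain v where "v \<in> W" "w \<subseteq> v" "x \<in> v" by blast
  then show thesis using that by (simp add: in_extent)
next
  case False
  then have "w \<in> Interior (W - extent x)"
    using assms by (simp add: Interior_def in_extent)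
  then show thesis using that[of w] assms by simp
qed

text \<open>Climb from \<open>w\<close> until the tail of the list, then \<open>y\<close>, then
  \<open>x\<close> are decided. Decisions persist upwards, and Boolean combinations of decided sets
  are decided.\<close>

lemma decided_above:
  assumes "a \<in> B" "w \<in> W"
  obtains v where "v \<in> W" "w \<subseteq> v" "v \<in> Interior a \<union> Interior (W - a)"
proof -
  have "\<exists>v\<in>W. w \<subseteq> v \<and> v \<in> Interior (cnf S) \<union> Interior (W - cnf S)" for S
  proof (induction S)
    case Nil
    have "w \<in> Interior (cnf [])" using assms by (simp add: Interior_def cnf_def)
    then show ?case using assms by blast
  next
    case (Cons s S)
    obtain x y where s: "s = (x, y)" by fastforce
    from Cons obtain v where v: "v \<in> W" "w \<subseteq> v" "v \<in> Interior (cnf S) \<union> Interior (W - cnf S)" by blast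
    obtain u where u: "u \<in> W" "v \<subseteq> u" "u \<in> Interior (extent y) \<union> Interior (W - extent y)"
      using extent_decided_above[OF v(1)] .
    obtain t where t: "t \<in> W" "u \<subseteq> t" "t \<in> Interior (extent x) \<union> Interior (W - extent x)"
      using extent_decided_above[OF u(1)] .
    have eq: "cnf (s # S) = ((W - extent x) \<union> extent y) \<inter> cnf S"
      by (auto simp: cnf_def extent_def s)
    have vt: "v \<subseteq> t" using t(2) u(2) by simp
    have "t \<in> Interior (cnf S) \<union> Interior (W - cnf S)"
      using v(3) Interior_up[OF _ vt t(1)] by blast
    moreover have "t \<in> Interior (extent y) \<union> Interior (W - extent y)"
      using u(3) Interior_up[OF _ t(2,1)] by blast
    ultimately have "t \<in> Interior (cnf (s # S)) \<union> Interior (W - cnf (s # S))"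
      using t(3) unfolding eq Interior_def by blast
    moreover have "w \<subseteq> t" using v(2) vt by simp
    ultimately show ?case using t(1) by blast
  qed
  with assms that show thesis by (auto simp: B_def)
qed

section \<open>The twist structure\<close>

text \<open>For such \<open>e\<close>, \<open>[e]\<close> is \<open>[e] \<union> [~e]\<close>;
  conversely each \<open>[x] \<union> [~x]\<close> is an extent of this kind. The generators are
  closed under intersection and are open.\<close>

definition Nabla :: "fm set set set" where
  "Nabla = {a. \<exists>e. extent (\<^bold>\<sim>e) = {} \<and> extent e \<subseteq> a}"

text \<open>For such \<open>k\<close>, \<open>[~k]\<close> is \<open>[k] \<inter> [~k]\<close>.
  Taking closures makes the ideal stable under \<open>Cl\<close>, as the falsity component of a box
  requires.\<close>

definition Delta :: "fm set set set" where
  "Delta = {a. \<exists>k. extent k = W \<and> a \<subseteq> Cl (extent (\<^bold>\<sim>k))}"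

lemma Nabla_up: "a \<in> Nabla \<Longrightarrow> a \<subseteq> b \<Longrightarrow> b \<in> Nabla"
  by (auto simp: Nabla_def)

lemma Delta_down: "a \<in> Delta \<Longrightarrow> b \<subseteq> a \<Longrightarrow> b \<in> Delta"
  by (auto simp: Delta_def)

lemma Nabla_Int:
  assumes "a \<in> Nabla" "b \<in> Nabla" shows "a \<inter> b \<in> Nabla"
proof -
  from assms obtain d e where "extent (\<^bold>\<sim>d) = {}" "extent d \<subseteq> a" "extent (\<^bold>\<sim>e) = {}" "extent e \<subseteq> b"
    by (auto simp: Nabla_def)
  then have "extent (\<^bold>\<sim>(d \<^bold>\<and> e)) = {}" "extent (d \<^bold>\<and> e) \<subseteq> a \<inter> b" by (auto simp: extent_def)
  then show ?thesis unfolding Nabla_def by blast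
qed

lemma Delta_Un:
  assumes "a \<in> Delta" "b \<in> Delta" shows "a \<union> b \<in> Delta"
proof -
  from assms obtain k l where *: "extent k = W" "a \<subseteq> Cl (extent (\<^bold>\<sim>k))"
      "extent l = W" "b \<subseteq> Cl (extent (\<^bold>\<sim>l))"
    by (auto simp: Delta_def)
  have "extent (\<^bold>\<sim>(k \<^bold>\<and> l)) = extent (\<^bold>\<sim>k) \<union> extent (\<^bold>\<sim>l)" by (auto simp: extent_def)
  with * have "a \<union> b \<subseteq> Cl (extent (\<^bold>\<sim>(k \<^bold>\<and> l)))" by (auto simp: Cl_Un)
  moreover have "extent (k \<^bold>\<and> l) = W" using * by (auto simp: extent_def)
  ultimately show ?thesis unfolding Delta_def by blast
qed

lemma Nabla_Interior:
  assumes "a \<in> Nabla" shows "Interior a \<in> Nabla"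
proof -
  from assms obtain e where e: "extent (\<^bold>\<sim>e) = {}" "extent e \<subseteq> a" by (auto simp: Nabla_def)
  from Interior_mono[OF e(2)] have "extent e \<subseteq> Interior a" by simp
  with e(1) show ?thesis by (auto simp: Nabla_def)
qed

lemma Delta_Cl:
  assumes "a \<in> Delta" shows "Cl a \<in> Delta"
proof -
  from assms obtain k where k: "extent k = W" "a \<subseteq> Cl (extent (\<^bold>\<sim>k))" by (auto simp: Delta_def)
  from Cl_mono[OF k(2)] Cl_Cl have "Cl a \<subseteq> Cl (extent (\<^bold>\<sim>k))" by blast
  with k(1) show ?thesis by (auto simp: Delta_def)
qed

lemma extent_Un_SNeg_in_Nabla: "extent x \<union> extent (\<^bold>\<sim>x) \<in> Nabla"
proof -
  \<comment> \<open>The last disjunct is equivalent to \<open>x\<close> and \<open>~x\<close>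
    together, so it leaves the extent unchanged; in \<open>~?e\<close> it contributes the negation
    of this contradiction, which clashes with \<open>~(x or ~x)\<close>.\<close>
  let ?e = "(x \<^bold>\<or> \<^bold>\<sim>x) \<^bold>\<or> \<^bold>\<sim>(\<^bold>\<not>(x \<^bold>\<and> \<^bold>\<sim>x))"
  have "extent (\<^bold>\<sim>?e) = {}" "extent ?e \<subseteq> extent x \<union> extent (\<^bold>\<sim>x)"
    by (auto simp: extent_def world_Imp)
  then show ?thesis unfolding Nabla_def by blast
qed

lemma extent_Int_SNeg_in_Delta: "extent x \<inter> extent (\<^bold>\<sim>x) \<in> Delta"
proof -
  let ?k = "(x \<^bold>\<and> \<^bold>\<sim>x) \<^bold>\<rightarrow> (x \<^bold>\<or> \<^bold>\<sim>x)"
  have "extent ?k = W" "extent x \<inter> extent (\<^bold>\<sim>x) \<subseteq> extent (\<^bold>\<sim>?k)"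
    by (auto simp: extent_def world_Imp)
  moreover have "extent (\<^bold>\<sim>?k) \<subseteq> Cl (extent (\<^bold>\<sim>?k))"
    by (rule subset_Cl) (auto simp: extent_def)
  ultimately show ?thesis unfolding Delta_def by blast
qed

lemma W_in_Nabla: "W \<in> Nabla"
  by (rule Nabla_up[OF extent_Un_SNeg_in_Nabla[of Bot]]) (auto simp: extent_def)

lemma empty_in_Delta: "{} \<in> Delta"
  by (rule Delta_down[OF extent_Int_SNeg_in_Delta[of Bot]]) auto

lemma decided_in_Nabla:
  assumes "a \<in> B" shows "Interior a \<union> Interior (W - a) \<in> Nabla"
proof -
  obtain x where x: "Interior a = extent x" using Interior_is_extent assms by blast
  obtain y where y: "Interior (W - a) = extent y" using Interior_is_extent B_compl[OF assms] by blast
  \<comment> \<open>The extent is that of the disjunction of \<open>x\<close> and \<open>y\<close>,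
    but \<open>~?e\<close> now amounts to the intuitionistic negation of that disjunction, which
    density makes empty.\<close>
  let ?e = "\<^bold>\<sim>(\<^bold>\<not>(x \<^bold>\<or> y))"
  have "w \<notin> extent (\<^bold>\<sim>?e)" for w
  proof
    assume w: "w \<in> extent (\<^bold>\<sim>?e)"
    then have "w \<in> W" by (simp add: extent_def)
    then obtain v where v: "v \<in> W" "w \<subseteq> v" "v \<in> extent x \<union> extent y"
      using decided_above[OF assms] x y by metis
    with w show False by (auto simp: extent_def world_Imp)
  qed
  moreover have "extent ?e \<subseteq> Interior a \<union> Interior (W - a)" by (auto simp: x y extent_def)
  ultimately show ?thesis unfolding Nabla_def by blast
qed

text \<open>At worlds that decide \<open>a\<close> the interior does distribute over the union: if
  every extension lies in \<open>a \<union> b\<close> and none in \<open>a\<close>, all lie in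
  \<open>b\<close>.\<close>

lemma Nabla_Interior_Un:
  assumes "a \<in> B" "a \<union> b \<in> Nabla" shows "Interior a \<union> Interior b \<in> Nabla"
proof (rule Nabla_up)
  show "Interior (a \<union> b) \<inter> (Interior a \<union> Interior (W - a)) \<in> Nabla"
    using assms by (intro Nabla_Int Nabla_Interior decided_in_Nabla)
  show "Interior (a \<union> b) \<inter> (Interior a \<union> Interior (W - a)) \<subseteq> Interior a \<union> Interior b"
    by (auto simp: Interior_def)
qed

section \<open>Modal semantics over the twist structure\<close>

definition Tw :: "(fm set set \<times> fm set set) set" where
  "Tw = {(a, b). a \<in> B \<and> b \<in> B \<and> a \<union> b \<in> Nabla \<and> a \<inter> b \<in> Delta}"

text \<open>The components are the truth set and the truth set of the strong negation.
  \<open>Box\<close> acts dually on the second because it must agree with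
  \<open>~ Dia ~\<close>.\<close>

primrec mval :: "(nat \<Rightarrow> fm set set \<times> fm set set) \<Rightarrow> mfm \<Rightarrow> fm set set \<times> fm set set" where
  "mval v (MVar n) = v n"
| "mval v MBot = ({}, W)"
| "mval v (\<phi> \<^bold>\<and>\<^sub>m \<psi>) = (fst (mval v \<phi>) \<inter> fst (mval v \<psi>), snd (mval v \<phi>) \<union> snd (mval v \<psi>))"
| "mval v (\<phi> \<^bold>\<or>\<^sub>m \<psi>) = (fst (mval v \<phi>) \<union> fst (mval v \<psi>), snd (mval v \<phi>) \<inter> snd (mval v \<psi>))"
| "mval v (\<phi> \<^bold>\<rightarrow>\<^sub>m \<psi>) =
    ((W - fst (mval v \<phi>)) \<union> fst (mval v \<psi>), fst (mval v \<phi>) \<inter> snd (mval v \<psi>))"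
| "mval v (\<^bold>\<sim>\<^sub>m\<phi>) = (snd (mval v \<phi>), fst (mval v \<phi>))"
| "mval v (\<^bold>\<box>\<phi>) = (Interior (fst (mval v \<phi>)), Cl (snd (mval v \<phi>)))"
| "mval v (\<^bold>\<diamond>\<phi>) = (Cl (fst (mval v \<phi>)), Interior (snd (mval v \<phi>)))"

lemma Tw_subset: "p \<in> Tw \<Longrightarrow> fst p \<subseteq> W" "p \<in> Tw \<Longrightarrow> snd p \<subseteq> W"
  using B_subset[of "fst p"] B_subset[of "snd p"] by (auto simp: Tw_def)

lemma Tw_swap: "(a, b) \<in> Tw \<Longrightarrow> (b, a) \<in> Tw"
  by (auto simp: Tw_def Un_commute Int_commute)

lemma Tw_meet:
  assumes "(a, a') \<in> Tw" "(b, b') \<in> Tw" shows "(a \<inter> b, a' \<union> b') \<in> Tw"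
proof -
  have "(a \<union> a') \<inter> (b \<union> b') \<in> Nabla" "(a \<inter> a') \<union> (b \<inter> b') \<in> Delta"
    using assms by (auto simp: Tw_def intro: Nabla_Int Delta_Un)
  then have "(a \<inter> b) \<union> (a' \<union> b') \<in> Nabla" "(a \<inter> b) \<inter> (a' \<union> b') \<in> Delta"
    by (auto elim: Nabla_up Delta_down)
  with assms show ?thesis by (auto simp: Tw_def)
qed

lemma Tw_join:
  assumes "(a, a') \<in> Tw" "(b, b') \<in> Tw" shows "(a \<union> b, a' \<inter> b') \<in> Tw"
  using Tw_meet[OF assms[THEN Tw_swap], THEN Tw_swap] .

text \<open>Both conditions come from \<open>(b, b')\<close>: the new union contains
  \<open>b \<union> b'\<close>, the new intersection lies in \<open>b \<inter> b'\<close>.\<close>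

lemma Tw_imp:
  assumes "(a, a') \<in> Tw" "(b, b') \<in> Tw" shows "((W - a) \<union> b, a \<inter> b') \<in> Tw"
proof -
  have "b \<union> b' \<in> Nabla" "b \<inter> b' \<in> Delta" and sub: "b' \<subseteq> W"
    using assms B_subset by (auto simp: Tw_def)
  then have "((W - a) \<union> b) \<union> (a \<inter> b') \<in> Nabla" "((W - a) \<union> b) \<inter> (a \<inter> b') \<in> Delta"
    by (auto elim!: Nabla_up Delta_down)
  with assms show ?thesis by (auto simp: Tw_def)
qed

lemma Tw_box:
  assumes "(a, b) \<in> Tw" shows "(Interior a, Cl b) \<in> Tw"
proof -
  have "Interior (a \<union> b) \<in> Nabla" "Cl (a \<inter> b) \<in> Delta"
    using assms by (auto simp: Tw_def intro: Nabla_Interior Delta_Cl)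
  moreover have "Interior (a \<union> b) \<subseteq> Interior a \<union> Cl b" "Interior a \<inter> Cl b \<subseteq> Cl (a \<inter> b)"
    by (auto simp: Interior_def Cl_def)
  ultimately have "Interior a \<union> Cl b \<in> Nabla" "Interior a \<inter> Cl b \<in> Delta"
    by (auto elim: Nabla_up Delta_down)
  with assms show ?thesis by (auto simp: Tw_def)
qed

lemma mval_in_Tw:
  assumes "\<And>n. v n \<in> Tw" shows "mval v \<phi> \<in> Tw"
proof (induction \<phi>)
  case MBot
  show ?case by (auto simp: Tw_def W_in_Nabla empty_in_Delta)
next
  case (MAnd \<phi> \<psi>)
  then show ?case
    using Tw_meet[of "fst (mval v \<phi>)" "snd (mval v \<phi>)"
      "fst (mval v \<psi>)" "snd (mval v \<psi>)"] by simp
next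
  case (MOr \<phi> \<psi>)
  then show ?case
    using Tw_join[of "fst (mval v \<phi>)" "snd (mval v \<phi>)"
      "fst (mval v \<psi>)" "snd (mval v \<psi>)"] by simp
next
  case (MImp \<phi> \<psi>)
  then show ?case
    using Tw_imp[of "fst (mval v \<phi>)" "snd (mval v \<phi>)"
      "fst (mval v \<psi>)" "snd (mval v \<psi>)"] by simp
next
  case (MSNeg \<phi>)
  then show ?case using Tw_swap[of "fst (mval v \<phi>)" "snd (mval v \<phi>)"] by simp
next
  case (Box \<phi>)
  then show ?case using Tw_box[of "fst (mval v \<phi>)" "snd (mval v \<phi>)"] by simp
next
  case (Dia \<phi>)
  \<comment> \<open>\<open>Dia\<close> is \<open>Box\<close> conjugated by swapping
    components.\<close>
  then have "(snd (mval v \<phi>), fst (mval v \<phi>)) \<in> Tw" using Tw_swap[of "fst (mval v \<phi>)" "snd (mval v \<phi>)"] by simp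
  from Tw_swap[OF Tw_box[OF this]] show ?case by simp
qed (simp add: assms)

lemma mval_msubst: "mval v (msubst \<sigma> \<phi>) = mval (\<lambda>n. mval v (\<sigma> n)) \<phi>"
  by (induction \<phi>) simp_all

definition valid :: "mfm set" where
  "valid = {\<phi>. \<forall>v. (\<forall>n. v n \<in> Tw) \<longrightarrow> fst (mval v \<phi>) = W}"

lemma fst_mval_subset: "(\<And>n. v n \<in> Tw) \<Longrightarrow> fst (mval v \<phi>) \<subseteq> W"
  using Tw_subset mval_in_Tw by blast

lemma mval_Imp_eq_W_iff:
  assumes "\<And>n. v n \<in> Tw"
  shows "fst (mval v (\<phi> \<^bold>\<rightarrow>\<^sub>m \<psi>)) = W \<longleftrightarrow> fst (mval v \<phi>) \<subseteq> fst (mval v \<psi>)"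
  using fst_mval_subset[of v \<phi>] fst_mval_subset[of v \<psi>] assms by auto

text \<open>Substitution composes with a valuation to give one that is again in \<open>Tw\<close>;
  the modal rules are monotonicity of \<open>Interior\<close> and \<open>Cl\<close>.\<close>

lemma is_mlogic_valid: "is_mlogic valid"
  unfolding is_mlogic_def
proof (intro conjI allI impI)
  fix \<sigma> \<phi> assume *: "\<phi> \<in> valid"
  show "msubst \<sigma> \<phi> \<in> valid"
    unfolding valid_def
  proof (clarify)
    fix v :: "nat \<Rightarrow> fm set set \<times> fm set set" assume "\<forall>n. v n \<in> Tw"
    then have "\<forall>n. mval v (\<sigma> n) \<in> Tw" using mval_in_Tw by blast
    then show "fst (mval v (msubst \<sigma> \<phi>)) = W"
      using * by (simp add: valid_def mval_msubst)
  qed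
next
  fix \<phi> \<psi> assume "\<phi> \<in> valid" "\<phi> \<^bold>\<rightarrow>\<^sub>m \<psi> \<in> valid"
  then show "\<psi> \<in> valid"
    using mval_Imp_eq_W_iff fst_mval_subset unfolding valid_def by blast
next
  fix \<phi> \<psi> assume "\<phi> \<^bold>\<rightarrow>\<^sub>m \<psi> \<in> valid"
  then have *: "fst (mval v \<phi>) \<subseteq> fst (mval v \<psi>)" if "\<And>n. v n \<in> Tw" for v
    using mval_Imp_eq_W_iff that unfolding valid_def by blast
  show "\<^bold>\<box>\<phi> \<^bold>\<rightarrow>\<^sub>m \<^bold>\<box>\<psi> \<in> valid" "\<^bold>\<diamond>\<phi> \<^bold>\<rightarrow>\<^sub>m \<^bold>\<diamond>\<psi> \<in> valid"
    using * Interior_mono Cl_mono by (auto simp: valid_def mval_Imp_eq_W_iff simp del: mval.simps(5))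
qed

text \<open>Truth components are Boolean, the twist operations build in the laws of
  \<open>~\<close>, and inclusion is reflexive and transitive, which gives the S4 laws.\<close>

lemma BS4_axioms_valid: "BS4_axioms \<subseteq> valid"
proof
  fix \<phi> assume ax: "\<phi> \<in> BS4_axioms"
  show "\<phi> \<in> valid"
    unfolding valid_def
  proof clarify
    fix v :: "nat \<Rightarrow> fm set set \<times> fm set set"
    assume v: "\<forall>n. v n \<in> Tw"
    have sub: "fst (v n) \<subseteq> W" "snd (v n) \<subseteq> W" for n
      using v Tw_subset by blast+
    from ax show "fst (mval v \<phi>) = W"
      using sub[of 0] sub[of 1] sub[of 2]
      unfolding BS4_axioms_def N4bot_axioms_def Let_def
      by (auto simp: Interior_def Cl_def)
  qed
qed

end

section \<open>Evaluating translated formulas\<close>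

locale regular_n4_logic = n4_logic +
  assumes regular: "\<^bold>\<not>(\<^bold>\<not>(Var 0 \<^bold>\<and> \<^bold>\<sim>(Var 0))) \<^bold>\<leftrightarrow> (Var 0 \<^bold>\<and> \<^bold>\<sim>(Var 0)) \<in> L"
begin

text \<open>As \<open>k\<close> is valid, \<open>[~k]\<close> is the extent of a contradiction,
  hence regular open, and an open set inside its closure lies inside \<open>[~k]\<close>
  itself.\<close>

lemma extent_contradiction_regular:
  assumes "a \<in> Delta" "extent x \<subseteq> a"
  obtains k where "extent k = W" "extent x \<subseteq> extent (\<^bold>\<sim>k)"
proof -
  from assms obtain k where k: "extent k = W" "extent x \<subseteq> Cl (extent (\<^bold>\<sim>k))"
    by (auto simp: Delta_def)
  have ax: "\<^bold>\<not>(\<^bold>\<not>(k \<^bold>\<and> \<^bold>\<sim>k)) \<^bold>\<leftrightarrow> (k \<^bold>\<and> \<^bold>\<sim>k) \<in> L"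
    using subst_closed[OF regular, of "\<lambda>_. k"] by simp
  have "w \<in> extent (\<^bold>\<sim>k)" if w: "w \<in> extent x" for w
  proof -
    from w have wW: "w \<in> W" by (simp add: extent_def)
    have "\<exists>u\<in>W. v \<subseteq> u \<and> \<^bold>\<sim>k \<in> u" if "v \<in> W" "w \<subseteq> v" for v
    proof -
      have "v \<in> Cl (extent (\<^bold>\<sim>k))" using that w k(2) by (auto simp: extent_def)
      then show ?thesis by (auto simp: Cl_def extent_def)
    qed
    moreover have "k \<in> u" if "u \<in> W" for u using k(1) that by (auto simp: extent_def)
    ultimately have "\<^bold>\<not>(\<^bold>\<not>(k \<^bold>\<and> \<^bold>\<sim>k)) \<in> w" using wW by (simp add: world_Imp)
    then show ?thesis using world_iff[OF wW ax] wW by (simp add: extent_def)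
  qed
  with k(1) that show thesis by blast
qed

text \<open>This is the surjectivity part of Odintsov's representation of \<open>N4\<close>-lattices as twist
  structures. Writing formulas as pairs of extents, \<open>e\<close> is \<open>(E, {})\<close> with \<open>E \<subseteq> [x] \<union> [y]\<close>,
  \<open>k\<close> is \<open>(W, K)\<close> with \<open>[x] \<inter> [y] \<subseteq> K\<close>, and \<open>g\<close> is \<open>([x] \<inter> [y], W)\<close>; implication into
  \<open>g\<close> acts as a negation relative to \<open>[x] \<inter> [y]\<close>.\<close>

lemma Tw_interior_realized:
  assumes "(a, b) \<in> Tw"
  obtains c where "extent c = Interior a" "extent (\<^bold>\<sim>c) = Interior b"
proof -
  have B: "a \<in> B" "b \<in> B" and N: "a \<union> b \<in> Nabla" and D: "a \<inter> b \<in> Delta"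
    using assms by (auto simp: Tw_def)
  obtain x where x: "Interior a = extent x" using Interior_is_extent B by blast
  obtain y where y: "Interior b = extent y" using Interior_is_extent B by blast
  obtain e where e: "extent (\<^bold>\<sim>e) = {}" "extent e \<subseteq> extent x \<union> extent y"
    using Nabla_Interior_Un[OF B(1) N] by (auto simp: Nabla_def x y)
  have "extent (x \<^bold>\<and> y) = Interior a \<inter> Interior b" by (auto simp: x y extent_def)
  then have "extent (x \<^bold>\<and> y) \<subseteq> a \<inter> b" using Interior_subset by blast
  then obtain k where k: "extent k = W" "extent (x \<^bold>\<and> y) \<subseteq> extent (\<^bold>\<sim>k)"
    using extent_contradiction_regular[OF D] by blast
  define g where "g = \<^bold>\<sim>((x \<^bold>\<and> y) \<^bold>\<rightarrow> k)"
  have g: "g \<in> w \<longleftrightarrow> x \<in> w \<and> y \<in> w" "\<^bold>\<sim>g \<in> w" if "w \<in> W" for w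
    using k that by (auto simp: g_def extent_def world_Imp)
  have e': "\<^bold>\<sim>e \<notin> w" "e \<in> w \<Longrightarrow> x \<in> w \<or> y \<in> w" if "w \<in> W" for w
    using e that by (auto simp: extent_def)
  \<comment> \<open>The first disjunct has the pair \<open>(E \<inter> [y -> g], [y])\<close> and
    the second \<open>([x], [x -> g])\<close>. The join is \<open>([x], [y])\<close>, since
    \<open>E \<inter> [y -> g]\<close> lies in \<open>[x]\<close> and \<open>[y]\<close> lies in
    \<open>[x -> g]\<close>.\<close>
  define c where "c = (e \<^bold>\<and> (y \<^bold>\<rightarrow> g)) \<^bold>\<or> \<^bold>\<sim>(x \<^bold>\<rightarrow> g)"
  have "c \<in> w \<longleftrightarrow> x \<in> w" if w: "w \<in> W" for w
    using w g[OF w] e'[OF w] world_mp[OF w, of y g] by (auto simp: c_def)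
  moreover have "\<^bold>\<sim>c \<in> w \<longleftrightarrow> y \<in> w" if w: "w \<in> W" for w
  proof -
    have "x \<^bold>\<rightarrow> g \<in> w" if "y \<in> w" using w that g(1) by (auto simp: world_Imp)
    then show ?thesis using w g[OF w] e'[OF w] by (auto simp: c_def)
  qed
  ultimately have "extent c = Interior a" "extent (\<^bold>\<sim>c) = Interior b" by (auto simp: x y extent_def)
  with that show thesis by blast
qed

text \<open>\<open>TB\<close> pushes \<open>~\<close> down to variables and \<open>Bot\<close>, so
  truth components suffice; boxed literals give the two interiors, and the interior of a Boolean
  implication between extents is the extent of the implication.\<close>

lemma mval_TB:
  assumes "\<And>n. extent (\<tau> n) = Interior (fst (v n))" "\<And>n. extent (\<^bold>\<sim>(\<tau> n)) = Interior (snd (v n))"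
  shows "fst (mval v (TB \<phi>)) = extent (subst \<tau> \<phi>)"
proof (induction \<phi> rule: TB.induct)
  case (5 \<phi> \<psi>)
  then show ?case by (auto simp: Interior_def extent_def world_Imp)
qed (auto simp: assms in_extent)

lemma TB_valid:
  assumes "\<phi> \<in> L" shows "TB \<phi> \<in> valid"
  unfolding valid_def
proof clarify
  fix v :: "nat \<Rightarrow> fm set set \<times> fm set set"
    assume v: "\<forall>n. v n \<in> Tw"
  \<comment> \<open>Realizing the value of each variable turns the valuation into a
    substitution.\<close>
  have "\<exists>c. extent c = Interior (fst (v n)) \<and> extent (\<^bold>\<sim>c) = Interior (snd (v n))" for n
    using Tw_interior_realized[of "fst (v n)" "snd (v n)"] v by (metis prod.collapse)
  then obtain \<tau> where "\<And>n. extent (\<tau> n) = Interior (fst (v n)) \<and> extent (\<^bold>\<sim>(\<tau> n)) = Interior (snd (v n))"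
    by metis
  then have "fst (mval v (TB \<phi>)) = extent (subst \<tau> \<phi>)" by (intro mval_TB) auto
  then show "fst (mval v (TB \<phi>)) = W"
    using extent_eq_W_iff subst_closed[OF assms] by blast
qed

lemma subst_Var: "subst Var \<phi> = \<phi>"
  by (induction \<phi>) simp_all

text \<open>The canonical valuation consists of open sets, so it is realized by the identity
  substitution.\<close>

lemma TB_valid_imp_mem:
  assumes "TB \<phi> \<in> valid" shows "\<phi> \<in> L"
proof -
  define v where "v n = (extent (Var n), extent (\<^bold>\<sim>(Var n)))" for n
  have "v n \<in> Tw" for n
    using extent_Un_SNeg_in_Nabla extent_Int_SNeg_in_Delta by (auto simp: v_def Tw_def)
  then have "fst (mval v (TB \<phi>)) = W" using assms by (auto simp: valid_def)
  moreover have "fst (mval v (TB \<phi>)) = extent (subst Var \<phi>)"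
    by (rule mval_TB) (simp_all add: v_def)
  ultimately show ?thesis by (simp add: extent_eq_W_iff subst_Var)
qed

lemma tauB_subset_valid: "tauB L \<subseteq> valid"
proof -
  have "BS4 \<subseteq> valid"
    using is_mlogic_valid BS4_axioms_valid unfolding BS4_def least_mlogic_def by blast
  moreover have "TB ` L \<subseteq> valid"
    using TB_valid by blast
  ultimately show ?thesis
    using is_mlogic_valid unfolding tauB_def plus_mlogic_def least_mlogic_def by blast
qed

end

section \<open>Least modal logics and the companion property\<close>

lemma mlogic_closed:
  assumes "is_mlogic M"
  shows "\<phi> \<in> M \<Longrightarrow> msubst \<sigma> \<phi> \<in> M"
    and "\<phi> \<in> M \<Longrightarrow> \<phi> \<^bold>\<rightarrow>\<^sub>m \<psi> \<in> M \<Longrightarrow> \<psi> \<in> M"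
    and "\<phi> \<^bold>\<rightarrow>\<^sub>m \<psi> \<in> M \<Longrightarrow> \<^bold>\<box>\<phi> \<^bold>\<rightarrow>\<^sub>m \<^bold>\<box>\<psi> \<in> M"
    and "\<phi> \<^bold>\<rightarrow>\<^sub>m \<psi> \<in> M \<Longrightarrow> \<^bold>\<diamond>\<phi> \<^bold>\<rightarrow>\<^sub>m \<^bold>\<diamond>\<psi> \<in> M"
  using assms unfolding is_mlogic_def by blast+

lemma is_mlogic_Inter:
  assumes "\<And>M. M \<in> A \<Longrightarrow> is_mlogic M"
  shows "is_mlogic (\<Inter>A)"
  unfolding is_mlogic_def
proof (intro conjI allI impI InterI)
  fix \<sigma> \<phi> M assume "\<phi> \<in> \<Inter>A" and M: "M \<in> A"
  then show "msubst \<sigma> \<phi> \<in> M" using mlogic_closed(1)[OF assms[OF M]] by simp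
next
  fix \<phi> \<psi> M assume "\<phi> \<in> \<Inter>A" "\<phi> \<^bold>\<rightarrow>\<^sub>m \<psi> \<in> \<Inter>A" and M: "M \<in> A"
  then show "\<psi> \<in> M" using mlogic_closed(2)[OF assms[OF M], of \<phi> \<psi>] by simp
next
  fix \<phi> \<psi> M assume "\<phi> \<^bold>\<rightarrow>\<^sub>m \<psi> \<in> \<Inter>A" and M: "M \<in> A"
  then have "\<phi> \<^bold>\<rightarrow>\<^sub>m \<psi> \<in> M" by simp
  then show "\<^bold>\<box>\<phi> \<^bold>\<rightarrow>\<^sub>m \<^bold>\<box>\<psi> \<in> M" "\<^bold>\<diamond>\<phi> \<^bold>\<rightarrow>\<^sub>m \<^bold>\<diamond>\<psi> \<in> M"
    by (rule mlogic_closed(3,4)[OF assms[OF M]])+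
qed

lemma is_mlogic_least_mlogic: "is_mlogic (least_mlogic X)"
  unfolding least_mlogic_def by (rule is_mlogic_Inter) simp

theorem theorem4p1p3:
  fixes L :: "fm set"
  assumes "is_extension L
    (N4bot \<^bold>+ {\<^bold>\<not>(\<^bold>\<not>(Var 0 \<^bold>\<and> \<^bold>\<sim>(Var 0))) \<^bold>\<leftrightarrow> (Var 0 \<^bold>\<and> \<^bold>\<sim>(Var 0))})"
  shows "modal_companion (tauB L) L"
proof -
  let ?r = "\<^bold>\<not>(\<^bold>\<not>(Var 0 \<^bold>\<and> \<^bold>\<sim>(Var 0))) \<^bold>\<leftrightarrow> (Var 0 \<^bold>\<and> \<^bold>\<sim>(Var 0))"
  have "N4bot \<union> {?r} \<subseteq> N4bot \<^bold>+ {?r}" unfolding plus_logic_def least_logic_def by blast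
  then have L: "is_logic L" "N4bot \<subseteq> L" "?r \<in> L"
    using assms unfolding is_extension_def by blast+
  moreover have "N4bot_axioms \<subseteq> N4bot" unfolding N4bot_def least_logic_def by blast
  ultimately interpret regular_n4_logic L
    by unfold_locales blast+
  have "BS4 \<union> TB ` L \<subseteq> tauB L"
    unfolding tauB_def plus_mlogic_def least_mlogic_def by blast
  moreover have "is_mlogic (tauB L)"
    unfolding tauB_def plus_mlogic_def by (rule is_mlogic_least_mlogic)
  \<comment> \<open>Translations of members of \<open>L\<close> are generators of
    \<open>tauB L\<close>; conversely a translation in \<open>tauB L\<close> is valid in the twist
    model, so its source lies in \<open>L\<close>.\<close>
  ultimately show ?thesis
    using L tauB_subset_valid TB_valid_imp_mem
    unfolding modal_companion_def is_extension_def is_mextension_def by blast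
qed

end
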